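(* Let $C$ be a strict $\omega$-category and $n\ge0$. Let $\mathcal N(C)$ be its Street nerve and let $t\mathcal N(C)$ be the stratification consisting of the simplices of positive dimension corresponding to morphisms $|\Delta[m]|\to C$ ($m\ge1$) sending the unique non-unit $m$-cell of $|\Delta[m]|$ to a weakly invertible cell of $C$. Then the complicial set $(\mathcal N(C),t\mathcal N(C))$ is $n$-trivial if and only if $C$ is $n$-trivial.
   Context: **$\omega$-categories.** A (strict) $\omega$-category $C$ has sets $C_n$ of $n$-cells ($n\ge0$), source and target maps $d_k^-,d_k^+:C_n\to C_k$ ($k<n$) satisfying the globular identities, compositions $d*_k c$ of $n$-cells defined for $k<n$ whenever $d_k^+c=d_k^-d$, and units $1^m_c\in C_m$ for $c\in C_n$, $m>n$ (with $1_c:=1_c^{n+1}$), satisfying the usual strict associativity, interchange and unit laws. For an $n$-cell $c$, $c:a\to b$ means $d_{n-1}^-c=a$, $d_{n-1}^+c=b$. **Weakly invertible cells.** An invertibility set is a set $E\subset\coprod_{n>0}C_n$ such that for every $n\ge 0$ and every $(n+1)$-cell $b\in E$ there exist $\tilde b,c,c'\in E$ with $\tilde b\in C_{n+1}$, $c,c'\in C_{n+2}$ and $c:1_{d_n^-b}\to\tilde b*_n b$, $c':1_{d_n^+b}\to b*_n\tilde b$. A cell of positive dimension is weakly invertible if it belongs to some invertibility set. $C$ is $n$-trivial if all its cells of dimension $>n$ are weakly invertible. **Orientals and Street nerve.** For $n\ge0$ let $C_\bullet(\Delta[n])$ be the normalized chain complex: $C_k(\Delta[n])$ is the free abelian group on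 the nondegenerate $k$-simplices of $\Delta[n]$, with $\partial_{k}:C_{k+1}\to C_{k}$, $\partial v=\sum_i(-1)^i d_iv$ (degenerate faces counted as $0$), augmentation $e$ sending each vertex to $1$, and $C_k^*(\Delta[n])\subset C_k(\Delta[n])$ the submonoid generated by the nondegenerate simplices. The $n$-th oriental $|\Delta[n]|$ is the $\omega$-category whose $p$-cells are the families $(x_k^\alpha)_{0\le k\le p,\ \alpha\in\{-,+\}}$ with $x_k^\alpha\in C_k^*(\Delta[n])$, $x_p^-=x_p^+$, $\partial_{k-1}(x_k^\alpha)=x_{k-1}^+-x_{k-1}^-$ for $0<k\le p$, and $e(x_0^\pm)=1$. The cell $d_k^\alpha x$ ($k<p$) keeps the entries of index $<k$ and has both entries of index $k$ equal to $x_k^\alpha$; $1^m_x$ is obtained by adding zero entries; and for $d_k^-x=d_k^+y=z$, $x*_ky=x-z+y$ (entrywise, where $z$ is extended by $0$). These form a cosimplicial $\omega$-category, and $\mathcal N(C)_n:=\mathrm{Hom}_{\omega\text{-}\mathrm{cat}}(|\Delta[n]|,C)$. The unique non-unit $n$-cell of $|\Delta[n]|$ is the one whose entries of index $n$ equal the nondegenerate $n$-simplex of $\Delta[n]$. **Stratified and complicial sets.** A stratification of a simplicial set $X$ is a subset $tX\subset\coprod_{n>0}X_n$ (the marked simplices) containing all degenerate simplices. A complicial set is a stratified simplicial set with the right lifting property with respect to the complicial horn inclusions and complicial thinness extensions (the paper shows that $(\mathcal N(C),t\mathcal N(C))$ is one). A complicial set is $n$-trivial if all its simplices of dimension $>n$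 are marked. *)

theory Defs
  imports "HOL-Library.Poly_Mapping" "HOL-Library.FuncSet"
begin

section \<open>Strict omega-categories\<close>

datatype sign = Minus | Plus

text \<open>
  Since one type \<open>'a\<close> carries the cells of all dimensions, the sets \<open>Cells C n\<close> need not be
  disjoint; the operations therefore take the dimensions as arguments:
  \<open>bd C \<alpha> n k\<close> is \<open>d\<^sub>k\<^sup>\<alpha> : C\<^sub>n \<rightarrow> C\<^sub>k\<close> for \<open>k < n\<close>, \<open>cmp C n k x y\<close> is the composite \<open>x *\<^sub>k y\<close> of
  \<open>n\<close>-cells (meaningful when \<open>k < n\<close> and \<open>d\<^sub>k\<^sup>- x = d\<^sub>k\<^sup>+ y\<close>), and \<open>one C n m\<close> is
  \<open>c \<mapsto> 1\<^sup>m\<^sub>c : C\<^sub>n \<rightarrow> C\<^sub>m\<close> for \<open>n < m\<close>.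
\<close>

record 'a omega_cat =
  Cells :: "nat \<Rightarrow> 'a set"
  bd :: "sign \<Rightarrow> nat \<Rightarrow> nat \<Rightarrow> 'a \<Rightarrow> 'a"
  cmp :: "nat \<Rightarrow> nat \<Rightarrow> 'a \<Rightarrow> 'a \<Rightarrow> 'a"
  one :: "nat \<Rightarrow> nat \<Rightarrow> 'a \<Rightarrow> 'a"

definition composable :: "'a omega_cat \<Rightarrow> nat \<Rightarrow> nat \<Rightarrow> 'a \<Rightarrow> 'a \<Rightarrow> bool" where
  "composable C n k x y \<longleftrightarrow>
     k < n \<and> x \<in> Cells C n \<and> y \<in> Cells C n \<and> bd C Minus n k x = bd C Plus n k y"

locale omega_category =
  fixes C :: "'a omega_cat"
  assumes bd_cell:
    "\<lbrakk>k < n; x \<in> Cells C n\<rbrakk> \<Longrightarrow> bd C \<alpha> n k x \<in> Cells C k"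
  and cmp_cell:
    "composable C n k x y \<Longrightarrow> cmp C n k x y \<in> Cells C n"
  and one_cell:
    "\<lbrakk>n < m; x \<in> Cells C n\<rbrakk> \<Longrightarrow> one C n m x \<in> Cells C m"
  and globular:
    "\<lbrakk>j < k; k < n; x \<in> Cells C n\<rbrakk> \<Longrightarrow> bd C \<alpha> k j (bd C \<beta> n k x) = bd C \<alpha> n j x"
  and bd_cmp_less:
    "\<lbrakk>composable C n k x y; j < k\<rbrakk> \<Longrightarrow> bd C \<alpha> n j (cmp C n k x y) = bd C \<alpha> n j x"
  and bd_minus_cmp:
    "composable C n k x y \<Longrightarrow> bd C Minus n k (cmp C n k x y) = bd C Minus n k y"
  and bd_plus_cmp:
    "composable C n k x y \<Longrightarrow> bd C Plus n k (cmp C n k x y) = bd C Plus n k x"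
  and bd_cmp_greater:
    "\<lbrakk>composable C n k x y; k < j; j < n\<rbrakk> \<Longrightarrow>
      bd C \<alpha> n j (cmp C n k x y) = cmp C j k (bd C \<alpha> n j x) (bd C \<alpha> n j y)"
  and bd_one_less:
    "\<lbrakk>k < n; n < m; x \<in> Cells C n\<rbrakk> \<Longrightarrow> bd C \<alpha> m k (one C n m x) = bd C \<alpha> n k x"
  and bd_one_eq:
    "\<lbrakk>n < m; x \<in> Cells C n\<rbrakk> \<Longrightarrow> bd C \<alpha> m n (one C n m x) = x"
  and bd_one_greater:
    "\<lbrakk>n < k; k < m; x \<in> Cells C n\<rbrakk> \<Longrightarrow> bd C \<alpha> m k (one C n m x) = one C n k x"
  and one_one:
    "\<lbrakk>n < k; k < m; x \<in> Cells C n\<rbrakk> \<Longrightarrow> one C k m (one C n k x) = one C n m x"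
  and cmp_assoc:
    "\<lbrakk>composable C n k x y; composable C n k y z\<rbrakk> \<Longrightarrow>
      cmp C n k (cmp C n k x y) z = cmp C n k x (cmp C n k y z)"
  and cmp_one_left:
    "\<lbrakk>k < n; x \<in> Cells C n\<rbrakk> \<Longrightarrow> cmp C n k (one C k n (bd C Plus n k x)) x = x"
  and cmp_one_right:
    "\<lbrakk>k < n; x \<in> Cells C n\<rbrakk> \<Longrightarrow> cmp C n k x (one C k n (bd C Minus n k x)) = x"
  and one_cmp:
    "\<lbrakk>composable C n k x y; n < m\<rbrakk> \<Longrightarrow>
      one C n m (cmp C n k x y) = cmp C m k (one C n m x) (one C n m y)"
  and interchange:
    "\<lbrakk>j < k; composable C n k x y; composable C n k z w;
      composable C n j x z; composable C n j y w\<rbrakk> \<Longrightarrow>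
      cmp C n j (cmp C n k x y) (cmp C n k z w) = cmp C n k (cmp C n j x z) (cmp C n j y w)"

text \<open>Functors are extensional, so that equality of functors is equality in HOL.\<close>

definition omega_Hom :: "'a omega_cat \<Rightarrow> 'b omega_cat \<Rightarrow> (nat \<Rightarrow> 'a \<Rightarrow> 'b) set" where
  "omega_Hom C D = {f.
     (\<forall>n. f n \<in> Cells C n \<rightarrow>\<^sub>E Cells D n) \<and>
     (\<forall>\<alpha> n k. \<forall>x\<in>Cells C n. k < n \<longrightarrow> f k (bd C \<alpha> n k x) = bd D \<alpha> n k (f n x)) \<and>
     (\<forall>n k x y. composable C n k x y \<longrightarrow>
        f n (cmp C n k x y) = cmp D n k (f n x) (f n y)) \<and>
     (\<forall>n m. \<forall>x\<in>Cells C n. n < m \<longrightarrow> f m (one C n m x) = one D n m (f n x))}"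

definition is_unit_cell :: "'a omega_cat \<Rightarrow> nat \<Rightarrow> 'a \<Rightarrow> bool" where
  "is_unit_cell C n x \<longleftrightarrow> (\<exists>k<n. \<exists>y\<in>Cells C k. x = one C k n y)"

section \<open>Weakly invertible cells\<close>

text \<open>\<open>arrow C n c a b\<close> says that \<open>c : a \<rightarrow> b\<close> for an \<open>(n+1)\<close>-cell \<open>c\<close> and \<open>n\<close>-cells \<open>a\<close>, \<open>b\<close>.\<close>

definition arrow :: "'a omega_cat \<Rightarrow> nat \<Rightarrow> 'a \<Rightarrow> 'a \<Rightarrow> 'a \<Rightarrow> bool" where
  "arrow C n c a b \<longleftrightarrow>
     c \<in> Cells C (Suc n) \<and> bd C Minus (Suc n) n c = a \<and> bd C Plus (Suc n) n c = b"

text \<open>A subset of the coproduct of the \<open>C\<^sub>n\<close>, \<open>n > 0\<close>, is a set of pairs (dimension, cell).\<close>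

definition invertibility_set :: "'a omega_cat \<Rightarrow> (nat \<times> 'a) set \<Rightarrow> bool" where
  "invertibility_set C E \<longleftrightarrow>
     E \<subseteq> (SIGMA n:{0<..}. Cells C n) \<and>
     (\<forall>n b. (Suc n, b) \<in> E \<longrightarrow>
       (\<exists>b' c c'. (Suc n, b') \<in> E \<and> (Suc (Suc n), c) \<in> E \<and> (Suc (Suc n), c') \<in> E \<and>
          composable C (Suc n) n b' b \<and> composable C (Suc n) n b b' \<and>
          arrow C (Suc n) c (one C n (Suc n) (bd C Minus (Suc n) n b)) (cmp C (Suc n) n b' b) \<and>
          arrow C (Suc n) c' (one C n (Suc n) (bd C Plus (Suc n) n b)) (cmp C (Suc n) n b b')))"

definition weakly_invertible :: "'a omega_cat \<Rightarrow> nat \<Rightarrow> 'a \<Rightarrow> bool" where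
  "weakly_invertible C n x \<longleftrightarrow> (\<exists>E. invertibility_set C E \<and> (n, x) \<in> E)"

definition omega_cat_trivial :: "nat \<Rightarrow> 'a omega_cat \<Rightarrow> bool" where
  "omega_cat_trivial n C \<longleftrightarrow> (\<forall>m>n. \<forall>x\<in>Cells C m. weakly_invertible C m x)"

section \<open>Normalized chains of the standard simplices\<close>

text \<open>
  A \<open>k\<close>-simplex of \<open>\<Delta>[n]\<close>, i.e. a monotone map \<open>[k] \<rightarrow> [n]\<close>, is encoded as the sorted list of its
  \<open>k + 1\<close> values; it is nondegenerate iff the list is strictly increasing.
\<close>

definition nondeg_simplices :: "nat \<Rightarrow> nat \<Rightarrow> nat list set" where
  "nondeg_simplices n k = {v. length v = Suc k \<and> sorted_wrt (<) v \<and> set v \<subseteq> {..n}}"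

type_synonym chain = "nat list \<Rightarrow>\<^sub>0 int"

definition normalized :: "nat list \<Rightarrow> chain" where
  "normalized v = (if sorted_wrt (<) v then frag_of v else 0)"

definition pos_chains :: "nat \<Rightarrow> nat \<Rightarrow> chain set" where
  "pos_chains n k =
     {c. Poly_Mapping.keys c \<subseteq> nondeg_simplices n k \<and> (\<forall>v. Poly_Mapping.lookup c v \<ge> 0)}"

definition face :: "nat \<Rightarrow> nat list \<Rightarrow> nat list" where
  "face i v = take i v @ drop (Suc i) v"

text \<open>The degree of the chain is read off the lengths; only used in positive degrees.\<close>

definition boundary :: "chain \<Rightarrow> chain" where
  "boundary = frag_extend (\<lambda>v. \<Sum>i<length v. frag_cmul ((- 1) ^ i) (normalized (face i v)))"

definition augmentation :: "chain \<Rightarrow> int" where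
  "augmentation c = (\<Sum>v\<in>Poly_Mapping.keys c. Poly_Mapping.lookup c v)"

definition chain_map :: "(nat \<Rightarrow> nat) \<Rightarrow> chain \<Rightarrow> chain" where
  "chain_map \<phi> = frag_extend (\<lambda>v. normalized (map \<phi> v))"

section \<open>Orientals\<close>

text \<open>A family \<open>(x\<^sub>k\<^sup>\<alpha>)\<close> with \<open>k \<le> p\<close> is extended by zero to all \<open>k\<close>.\<close>

type_synonym ocell = "nat \<Rightarrow> sign \<Rightarrow> chain"

definition oriental_cells :: "nat \<Rightarrow> nat \<Rightarrow> ocell set" where
  "oriental_cells n p = {x.
     (\<forall>k\<le>p. \<forall>\<alpha>. x k \<alpha> \<in> pos_chains n k) \<and>
     (\<forall>k>p. \<forall>\<alpha>. x k \<alpha> = 0) \<and>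
     x p Minus = x p Plus \<and>
     (\<forall>k \<alpha>. 0 < k \<and> k \<le> p \<longrightarrow> boundary (x k \<alpha>) = x (k - 1) Plus - x (k - 1) Minus) \<and>
     (\<forall>\<alpha>. augmentation (x 0 \<alpha>) = 1)}"

definition oriental_bd :: "sign \<Rightarrow> nat \<Rightarrow> ocell \<Rightarrow> ocell" where
  "oriental_bd \<alpha> k x = (\<lambda>j \<beta>. if j < k then x j \<beta> else if j = k then x k \<alpha> else 0)"

definition oriental :: "nat \<Rightarrow> ocell omega_cat" where
  "oriental n = \<lparr>
     Cells = oriental_cells n,
     bd = (\<lambda>\<alpha> p k x. oriental_bd \<alpha> k x),
     cmp = (\<lambda>p k x y j \<beta>. x j \<beta> - oriental_bd Minus k x j \<beta> + y j \<beta>),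
     one = (\<lambda>p m x. x)\<rparr>"

definition oriental_top :: "nat \<Rightarrow> ocell" where
  "oriental_top n = (THE x. x \<in> Cells (oriental n) n \<and> \<not> is_unit_cell (oriental n) n x)"

definition oriental_map :: "(nat \<Rightarrow> nat) \<Rightarrow> ocell \<Rightarrow> ocell" where
  "oriental_map \<phi> x = (\<lambda>k \<alpha>. chain_map \<phi> (x k \<alpha>))"

section \<open>Stratified simplicial sets and the Street nerve\<close>

text \<open>
  \<open>act X m n \<phi> : X\<^sub>n \<rightarrow> X\<^sub>m\<close> is the action of a monotone map \<open>\<phi> : [m] \<rightarrow> [n]\<close>;
  \<open>marked X m\<close> is the set of marked \<open>m\<close>-simplices. On the nerve, \<open>\<phi>\<close> acts by precomposition
  with the cosimplicial structure map of the orientals.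
\<close>

record 's stratified_sset =
  Simp :: "nat \<Rightarrow> 's set"
  act :: "nat \<Rightarrow> nat \<Rightarrow> (nat \<Rightarrow> nat) \<Rightarrow> 's \<Rightarrow> 's"
  marked :: "nat \<Rightarrow> 's set"

definition stratified_trivial :: "nat \<Rightarrow> 's stratified_sset \<Rightarrow> bool" where
  "stratified_trivial n X \<longleftrightarrow> (\<forall>m>n. Simp X m \<subseteq> marked X m)"

definition street_nerve :: "'a omega_cat \<Rightarrow> (nat \<Rightarrow> ocell \<Rightarrow> 'a) stratified_sset" where
  "street_nerve C = \<lparr>
     Simp = (\<lambda>m. omega_Hom (oriental m) C),
     act = (\<lambda>m n \<phi> f p. \<lambda>x\<in>Cells (oriental m) p. f p (oriental_map \<phi> x)),
     marked = (\<lambda>m. {f \<in> omega_Hom (oriental m) C.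
                      m > 0 \<and> weakly_invertible C m (f m (oriental_top m))})\<rparr>"

end

theory Submission
  imports Defs
begin

text \<open>
  The non-unit \<open>m\<close>-cell of the \<open>m\<close>-th oriental is the atom whose entries of index \<open>k\<close> are the sums of
  the \<open>k\<close>-simplices of \<open>\<Delta>[m]\<close> satisfying an alternating gap condition (as in Gale's evenness condition
  for cyclic polytopes); so an \<open>n\<close>-trivial \<open>C\<close> has an \<open>n\<close>-trivial nerve. Conversely, sending
  \<open>[0, \<dots>, k - 1, k]\<close> and \<open>[0, \<dots>, k - 1, j]\<close> with \<open>j > k\<close> to the two \<open>k\<close>-cells of the \<open>m\<close>-globe, and all other
  simplices to \<open>0\<close>, is an augmentation preserving map of chain complexes with positive coefficients. The
  induced functor from the oriental to the globe sends the atom to the top cell of the globe, hence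
  every \<open>m\<close>-cell of \<open>C\<close> is the value at the atom of some \<open>m\<close>-simplex of the nerve.

  The same map, precomposed with the collapses \<open>[m] \<rightarrow> [k]\<close>, bounds coefficients of cells of the oriental
  by \<open>1\<close>, which yields the uniqueness of the non-unit \<open>m\<close>-cell.
\<close>

section \<open>Chains\<close>

definition chain_eval :: "(nat list \<Rightarrow> int) \<Rightarrow> chain \<Rightarrow> int" where
  "chain_eval h c = (\<Sum>v\<in>Poly_Mapping.keys c. Poly_Mapping.lookup c v * h v)"

lemma chain_eval_superset:
  assumes "finite S" "Poly_Mapping.keys c \<subseteq> S"
  shows "chain_eval h c = (\<Sum>v\<in>S. Poly_Mapping.lookup c v * h v)"
  unfolding chain_eval_def
  by (rule sum.mono_neutral_left) (use assms in \<open>auto simp: in_keys_iff\<close>)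

lemma chain_eval_zero [simp]: "chain_eval h 0 = 0"
  by (simp add: chain_eval_def)

lemma chain_eval_frag_of [simp]: "chain_eval h (frag_of v) = h v"
  by (simp add: chain_eval_def)

lemma chain_eval_add: "chain_eval h (c + d) = chain_eval h c + chain_eval h d"
proof -
  let ?S = "Poly_Mapping.keys c \<union> Poly_Mapping.keys d"
  have "Poly_Mapping.keys (c + d) \<subseteq> ?S"
    by (rule Poly_Mapping.keys_add)
  then show ?thesis
    by (simp add: chain_eval_superset[of ?S] lookup_add distrib_right sum.distrib)
qed

lemma chain_eval_minus: "chain_eval h (- c) = - chain_eval h c"
  by (simp add: chain_eval_def sum_negf)

lemma chain_eval_diff: "chain_eval h (c - d) = chain_eval h c - chain_eval h d"
  using chain_eval_add[of h c "- d"] by (simp add: chain_eval_minus)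

lemma chain_eval_cmul: "chain_eval h (frag_cmul k c) = k * chain_eval h c"
  unfolding chain_eval_superset[OF finite_keys keys_cmul]
  by (simp add: chain_eval_def sum_distrib_left mult.assoc)

lemma chain_eval_sum: "chain_eval h (\<Sum>i\<in>I. c i) = (\<Sum>i\<in>I. chain_eval h (c i))"
  by (induction I rule: infinite_finite_induct) (simp_all add: chain_eval_add)

lemma chain_eval_mono:
  assumes "\<And>v. 0 \<le> Poly_Mapping.lookup c v"
    and "\<And>v. v \<in> Poly_Mapping.keys c \<Longrightarrow> g v \<le> h v"
  shows "chain_eval g c \<le> chain_eval h c"
  unfolding chain_eval_def by (intro sum_mono mult_left_mono assms)

lemma augmentation_eq_chain_eval: "augmentation = chain_eval (\<lambda>_. 1)"
  by (simp add: fun_eq_iff augmentation_def chain_eval_def)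

lemma face_Cons_0 [simp]: "face 0 (a # v) = v"
  by (simp add: face_def)

lemma face_Cons_Suc [simp]: "face (Suc i) (a # v) = a # face i v"
  by (simp add: face_def)

lemma map_face: "map \<phi> (face i v) = face i (map \<phi> v)"
  by (simp add: face_def take_map drop_map)

lemma set_face: "set (face i v) \<subseteq> set v"
  by (auto simp: face_def dest: in_set_takeD in_set_dropD)

lemma sorted_wrt_face: "sorted_wrt R v \<Longrightarrow> sorted_wrt R (face i v)"
proof (induction v arbitrary: i)
  case (Cons a v)
  then show ?case
    using set_face[of _ v] by (cases i) auto
qed (simp add: face_def)

lemma boundary_frag_of:
  "boundary (frag_of v) = (\<Sum>i<length v. frag_cmul ((- 1) ^ i) (normalized (face i v)))"
  by (simp add: boundary_def)

lemma boundary_zero [simp]: "boundary 0 = 0"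
  by (simp add: boundary_def)

lemma boundary_add: "boundary (c + d) = boundary c + boundary d"
  by (simp add: boundary_def frag_extend_add)

lemma boundary_diff: "boundary (c - d) = boundary c - boundary d"
  by (simp add: boundary_def frag_extend_diff)

text \<open>The right side evaluates the coboundary of \<open>h\<close>. Faces of strictly
  increasing lists stay strictly increasing, so \<open>normalized\<close> discards nothing.\<close>

lemma chain_eval_boundary:
  assumes "Poly_Mapping.keys c \<subseteq> {v. sorted_wrt (<) v}"
  shows "chain_eval h (boundary c) = chain_eval (\<lambda>v. \<Sum>i<length v. (- 1) ^ i * h (face i v)) c"
  using assms
proof (induction c rule: frag_induction)
  case zero
  then show ?case by simp
next
  case (one v)
  then show ?case
    by (simp add: boundary_frag_of chain_eval_sum chain_eval_cmul normalized_def sorted_wrt_face)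
next
  case (diff a b)
  then show ?case by (simp add: boundary_diff chain_eval_diff)
qed

section \<open>Cones over chains with a new first vertex\<close>

definition cone :: "nat \<Rightarrow> chain \<Rightarrow> chain" where
  "cone a = frag_extend (\<lambda>v. frag_of (a # v))"

lemma cone_zero [simp]: "cone a 0 = 0"
  by (simp add: cone_def)

lemma cone_diff: "cone a (c - d) = cone a c - cone a d"
  by (simp add: cone_def frag_extend_diff)

lemma cone_frag_of [simp]: "cone a (frag_of v) = frag_of (a # v)"
  by (simp add: cone_def)

lemma lookup_cone:
  "Poly_Mapping.lookup (cone a c) v =
     (case v of [] \<Rightarrow> 0 | b # w \<Rightarrow> if b = a then Poly_Mapping.lookup c w else 0)"
  using subset_UNIV
proof (induction c rule: frag_induction)
  case (diff c d)
  then show ?case by (auto simp: cone_diff lookup_minus split: list.split)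
qed (auto split: list.split)

lemma cone_sum_cmul:
  "cone a (\<Sum>i\<in>I. frag_cmul (k i) (c i)) = (\<Sum>i\<in>I. frag_cmul (k i) (cone a (c i)))"
  by (induction I rule: infinite_finite_induct)
     (simp_all add: cone_def frag_extend_add frag_extend_cmul)

text \<open>Face 0 removes the apex; every other face keeps it, with shifted sign. The empty list
  counts as a simplex of degree -1, so the cone over it is covered as well.\<close>

lemma boundary_cone:
  assumes "Poly_Mapping.keys c \<subseteq> {v. sorted_wrt (<) (a # v)}"
  shows "boundary (cone a c) = c - cone a (boundary c)"
  using assms
proof (induction c rule: frag_induction)
  case (one v)
  then have v: "sorted_wrt (<) v" "\<And>x. x \<in> set v \<Longrightarrow> a < x"
    by auto
  have f: "normalized (face i v) = frag_of (face i v)"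
          "normalized (a # face i v) = frag_of (a # face i v)" for i
    using v set_face[of i v] by (auto simp: normalized_def sorted_wrt_face)
  have "boundary (cone a (frag_of v)) =
      (\<Sum>i<Suc (length v). frag_cmul ((- 1) ^ i) (normalized (face i (a # v))))"
    by (simp add: boundary_frag_of)
  also have "\<dots> = frag_of v - (\<Sum>i<length v. frag_cmul ((- 1) ^ i) (frag_of (a # face i v)))"
    unfolding sum.lessThan_Suc_shift using v(1)
    by (simp add: f sum_negf flip: minus_frag_cmul) (simp add: normalized_def)
  also have "\<dots> = frag_of v - cone a (boundary (frag_of v))"
    by (simp add: boundary_frag_of cone_sum_cmul f)
  finally show ?case .
qed (simp_all add: cone_diff boundary_diff)

section \<open>Gale chains\<close>

text \<open>
  \<open>gale_list \<delta> r a v\<close>: \<open>v\<close> arises by scanning \<open>a, \<dots>, a + r - 1\<close>, where elements may be omitted only while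
  the flag is true, and each kept element flips the flag, initially \<open>\<delta>\<close>.
\<close>

fun gale_list :: "bool \<Rightarrow> nat \<Rightarrow> nat \<Rightarrow> nat list \<Rightarrow> bool" where
  "gale_list \<delta> 0 a v \<longleftrightarrow> v = []"
| "gale_list \<delta> (Suc r) a v \<longleftrightarrow>
     \<delta> \<and> gale_list True r (Suc a) v \<or> (\<exists>w. v = a # w \<and> gale_list (\<not> \<delta>) r (Suc a) w)"

text \<open>The sum of the lists of length \<open>k\<close> accepted by \<open>gale_list\<close>,
  built by the same scan so that \<open>boundary_cone\<close> applies. As \<open>k\<close> counts
  vertices, the degree is \<open>k - 1\<close>.\<close>

fun gale_chain :: "bool \<Rightarrow> nat \<Rightarrow> nat \<Rightarrow> nat \<Rightarrow> chain" where
  "gale_chain \<delta> 0 a k = (if k = 0 then frag_of [] else 0)"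
| "gale_chain \<delta> (Suc r) a k =
     (if \<delta> then gale_chain True r (Suc a) k else 0) +
     (case k of 0 \<Rightarrow> 0 | Suc l \<Rightarrow> cone a (gale_chain (\<not> \<delta>) r (Suc a) l))"

lemma gale_list_bounds: "gale_list \<delta> r a v \<Longrightarrow> set v \<subseteq> {a..<a + r} \<and> sorted_wrt (<) v"
  by (induction r arbitrary: \<delta> a v) (simp; fastforce)+

lemma gale_list_length_le: "gale_list \<delta> r a v \<Longrightarrow> length v \<le> r"
  by (induction r arbitrary: \<delta> a v) (simp; fastforce)+

text \<open>With the flag false the first element must be kept; keeping it under both flags
  exchanges the flags, so no element is ever omitted.\<close>

lemma gale_list_disjoint: "gale_list True r a v \<Longrightarrow> gale_list False r a v \<Longrightarrow> length v = r"
  by (induction r arbitrary: a v) (auto dest: gale_list_bounds)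

lemma lookup_gale_chain:
  "Poly_Mapping.lookup (gale_chain \<delta> r a k) v = (if length v = k \<and> gale_list \<delta> r a v then 1 else 0)"
proof (induction r arbitrary: \<delta> a k v)
  case 0
  then show ?case by auto
next
  case (Suc r)
  \<comment> \<open>A list starting with \<open>a\<close> cannot come from a scan that begins at
    \<open>Suc a\<close>, so the two summands have disjoint supports and no coefficient reaches
    2.\<close>
  have "\<not> gale_list d r (Suc a) (a # w)" for d w
    using gale_list_bounds[of d r "Suc a" "a # w"] by auto
  then show ?case
    by (auto simp: lookup_add lookup_cone Suc split: list.split nat.split)
qed

lemma keys_gale_chain:
  "Poly_Mapping.keys (gale_chain \<delta> r a k) = {v. length v = k \<and> gale_list \<delta> r a v}"
  by (auto simp: in_keys_iff lookup_gale_chain split: if_splits)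

lemma gale_chain_0: "gale_chain \<delta> r a 0 = (if \<delta> \<or> r = 0 then frag_of [] else 0)"
  by (induction r arbitrary: a) auto

lemma gale_chain_eq_0: "r < k \<Longrightarrow> gale_chain \<delta> r a k = 0"
  by (rule poly_mapping_eqI) (auto simp: lookup_gale_chain dest: gale_list_length_le)

lemma boundary_cone_gale_chain:
  "boundary (cone a (gale_chain \<delta> r (Suc a) k)) =
     gale_chain \<delta> r (Suc a) k - cone a (boundary (gale_chain \<delta> r (Suc a) k))"
  by (rule boundary_cone) (auto simp: keys_gale_chain dest!: gale_list_bounds)

lemma boundary_frag_of_Nil [simp]: "boundary (frag_of []) = 0"
  by (simp add: boundary_frag_of)

lemma boundary_frag_of_singleton [simp]: "boundary (frag_of [a]) = frag_of []"
  by (simp add: boundary_frag_of normalized_def)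

text \<open>Induction with the cone formula: whether or not \<open>a\<close> may be omitted, the
  terms without \<open>a\<close> add up to \<open>gale_chain True r (Suc a) k\<close>. Hence the
  boundary is the same for both flags, as for the two entries of a cell.\<close>

lemma boundary_gale_chain:
  "boundary (gale_chain \<delta> r a (Suc k)) = gale_chain True r a k - gale_chain False r a k"
proof (induction r arbitrary: \<delta> a k)
  case 0
  then show ?case by simp
next
  case (Suc r)
  show ?case
  proof (cases k)
    case 0
    then show ?thesis
      by (auto simp: boundary_add Suc boundary_cone_gale_chain gale_chain_0)
  next
    case (Suc l)
    then show ?thesis
      by (auto simp: boundary_add Suc.IH boundary_cone_gale_chain cone_diff)
  qed
qed

lemma gale_list_upt: "gale_list \<delta> r a [a..<a + r]"
proof (induction r arbitrary: \<delta> a)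
  case (Suc r)
  have "[a..<a + Suc r] = a # [Suc a..<Suc a + r]"
    by (simp add: upt_conv_Cons)
  with Suc[of "\<not> \<delta>" "Suc a"] show ?case by (simp del: upt_Suc)
qed simp

text \<open>
  The fibres of \<open>\<phi>\<close> are consecutive blocks; if omission is not allowed on entering a block, keep its
  first element, and otherwise its last one.
\<close>

lemma gale_list_transversal:
  assumes "\<And>i. \<phi> i \<le> \<phi> (Suc i)" "\<And>i. \<phi> (Suc i) \<le> Suc (\<phi> i)"
  shows "\<exists>u. gale_list \<delta> (Suc r) a u \<and> map \<phi> u = [\<phi> a..<Suc (\<phi> (a + r))]"
    and "\<exists>u. gale_list True (Suc r) a u \<and> map \<phi> u = [Suc (\<phi> a)..<Suc (\<phi> (a + r))]"
proof (induction r arbitrary: \<delta> a)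
  case 0
  {
    case 1
    show ?case by (rule exI[of _ "[a]"]) simp
  next
    case 2
    show ?case by (rule exI[of _ "[]"]) simp
  }
next
  case (Suc r)
  have step: "\<phi> (Suc a) = \<phi> a \<or> \<phi> (Suc a) = Suc (\<phi> a)" for a
    using assms[of a] by linarith
  have keep: "\<exists>u. gale_list \<delta> (Suc (Suc r)) a u \<and> map \<phi> u = [\<phi> a..<Suc (\<phi> (a + Suc r))]"
    if "gale_list (\<not> \<delta>) (Suc r) (Suc a) u" "map \<phi> u = [Suc (\<phi> a)..<Suc (\<phi> (a + Suc r))]" for u \<delta> a
  proof -
    have "\<phi> a \<le> \<phi> (a + Suc r)"
      by (rule lift_Suc_mono_le) (use assms in auto)
    then have "[\<phi> a..<Suc (\<phi> (a + Suc r))] = \<phi> a # [Suc (\<phi> a)..<Suc (\<phi> (a + Suc r))]"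
      by (simp add: upt_conv_Cons)
    then show ?thesis
      by (intro exI[of _ "a # u"]) (use that in simp)
  qed
  have omit: "gale_list True (Suc (Suc r)) a u" if "gale_list True (Suc r) (Suc a) u" for a u
    using that by simp
  have shift: "Suc a + r = a + Suc r" for a
    by simp
  note IH1 = Suc(1)[of _ "Suc a" for a, unfolded shift] and IH2 = Suc(2)[of "Suc a" for a, unfolded shift]
  {
    case (1 \<delta> a)
    show ?case
      using step[of a]
    proof
      assume same: "\<phi> (Suc a) = \<phi> a"
      show ?thesis
      proof (cases \<delta>)
        case True
        then have \<delta>: "\<delta> = True" by simp
        obtain u where "gale_list True (Suc r) (Suc a) u" "map \<phi> u = [\<phi> a..<Suc (\<phi> (a + Suc r))]"
          using IH1[of True a, unfolded same] by blast
        with omit show ?thesis unfolding \<delta> by blast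
      next
        case False
        then have "(\<not> \<delta>) = True" by simp
        moreover obtain u where "gale_list True (Suc r) (Suc a) u"
          "map \<phi> u = [Suc (\<phi> a)..<Suc (\<phi> (a + Suc r))]"
          using IH2[of a, unfolded same] by blast
        ultimately show ?thesis
          using keep[of \<delta> a u] by metis
      qed
    next
      assume next_block: "\<phi> (Suc a) = Suc (\<phi> a)"
      obtain u where "gale_list (\<not> \<delta>) (Suc r) (Suc a) u"
        "map \<phi> u = [Suc (\<phi> a)..<Suc (\<phi> (a + Suc r))]"
        using IH1[of "\<not> \<delta>" a, unfolded next_block] by blast
      then show ?thesis
        by (rule keep)
    qed
  next
    case (2 a)
    have "\<exists>u. gale_list True (Suc r) (Suc a) u \<and> map \<phi> u = [Suc (\<phi> a)..<Suc (\<phi> (a + Suc r))]"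
      using step[of a]
    proof
      assume same: "\<phi> (Suc a) = \<phi> a"
      show ?thesis using IH2[of a] unfolding same .
    next
      assume next_block: "\<phi> (Suc a) = Suc (\<phi> a)"
      show ?thesis using IH1[of True a] unfolding next_block .
    qed
    with omit show ?case by blast
  }
qed

section \<open>Collapsing simplices to globes\<close>

text \<open>
  With \<open>a = 0\<close> and \<open>v\<close> of length \<open>k + 1\<close>, \<open>globe_atom\<close> is the coefficient in the image of \<open>v\<close> of one of the
  two \<open>k\<close>-cells of the globe and \<open>globe_total\<close> is the sum of both coefficients. That the collapse is
  a chain map amounts to \<open>sum_faces_globe_total\<close> and \<open>sum_faces_globe_atom\<close>.
\<close>

fun globe_total :: "nat \<Rightarrow> nat list \<Rightarrow> int" where
  "globe_total a [] = 0"
| "globe_total a [x] = of_bool (a \<le> x)"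
| "globe_total a (x # y # v) = of_bool (x = a) * globe_total (Suc a) (y # v)"

fun globe_atom :: "nat \<Rightarrow> nat list \<Rightarrow> int" where
  "globe_atom a [] = 1"
| "globe_atom a (x # v) = of_bool (x = a) * globe_atom (Suc a) v"

lemma globe_atom_nonneg: "0 \<le> globe_atom a v"
  by (induction a v rule: globe_atom.induct) auto

lemma globe_atom_le_total: "v \<noteq> [] \<Longrightarrow> globe_atom a v \<le> globe_total a v"
  by (induction a v rule: globe_total.induct) auto

lemma globe_atom_upt: "globe_atom a [a..<a + k] = 1"
proof (induction k arbitrary: a)
  case (Suc k)
  have "[a..<a + Suc k] = a # [Suc a..<Suc a + k]"
    by (simp add: upt_conv_Cons)
  with Suc[of "Suc a"] show ?case by (simp del: upt_Suc)
qed simp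

lemma sum_faces_Cons:
  fixes h :: "nat list \<Rightarrow> int"
  shows "(\<Sum>i<length (x # v). (- 1) ^ i * h (face i (x # v))) =
    h v - (\<Sum>i<length v. (- 1) ^ i * h (x # face i v))"
  by (simp add: sum.lessThan_Suc_shift sum_negf del: sum.lessThan_Suc)

text \<open>In use \<open>a = 0\<close>, where the right side is 0. The case \<open>x < a\<close>
  serves the induction: the lists are only weakly sorted, and a repeated entry falls below the
  raised bound.\<close>

lemma sum_faces_globe_total:
  assumes "sorted (x # u)" "u \<noteq> []"
  shows "(\<Sum>i<length (x # u). (- 1) ^ i * globe_total a (face i (x # u))) =
    of_bool (x < a) * globe_total a u"
  using assms
proof (induction u arbitrary: x a)
  case (Cons y u)
  show ?case
  proof (cases u)
    case Nil
    then show ?thesis using Cons.prems by (simp add: face_def)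
  next
    case (Cons z w)
    have "face i (y # u) \<noteq> []" for i
      using Cons by (auto simp: face_def)
    then have "globe_total a (x # face i (y # u)) = of_bool (x = a) * globe_total (Suc a) (face i (y # u))" for i
      by (metis globe_total.simps(3) neq_Nil_conv)
    then have "(\<Sum>i<length (x # y # u). (- 1) ^ i * globe_total a (face i (x # y # u))) =
       globe_total a (y # u) -
       of_bool (x = a) * (\<Sum>i<length (y # u). (- 1) ^ i * globe_total (Suc a) (face i (y # u)))"
      unfolding sum_faces_Cons[where x = x and v = "y # u"] by (simp add: sum_distrib_left mult_ac)
    also have "(\<Sum>i<length (y # u). (- 1) ^ i * globe_total (Suc a) (face i (y # u))) =
        of_bool (y < Suc a) * globe_total (Suc a) u"
      by (rule Cons.IH) (use Cons.prems Cons in auto)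
    finally show ?thesis
      using Cons.prems Cons by (auto simp del: of_bool_eq_iff)
  qed
qed simp

lemma sum_faces_globe_atom:
  assumes "sorted (x # u)"
  shows "(\<Sum>i<length (x # u). (- 1) ^ i * globe_atom a (face i (x # u))) =
    (if x < a then globe_atom a u else (- 1) ^ length u * globe_total a (x # u))"
  using assms
proof (induction u arbitrary: x a)
  case Nil
  then show ?case by simp
next
  case (Cons y u)
  have "(\<Sum>i<length (x # y # u). (- 1) ^ i * globe_atom a (face i (x # y # u))) =
     globe_atom a (y # u) -
     of_bool (x = a) * (\<Sum>i<length (y # u). (- 1) ^ i * globe_atom (Suc a) (face i (y # u)))"
    unfolding sum_faces_Cons[where x = x and v = "y # u"] by (simp add: sum_distrib_left mult_ac)
  also have "(\<Sum>i<length (y # u). (- 1) ^ i * globe_atom (Suc a) (face i (y # u))) =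
      (if y < Suc a then globe_atom (Suc a) u else (- 1) ^ length u * globe_total (Suc a) (y # u))"
    by (rule Cons.IH) (use Cons.prems in auto)
  finally show ?case
    using Cons.prems by (cases u) auto
qed

lemma strict_sorted_eq_upt:
  assumes "sorted_wrt (<) v" "length v = r" "set v \<subseteq> {a..<a + r}"
  shows "v = [a..<a + r]"
proof (rule sorted_distinct_set_unique)
  have sd: "sorted v \<and> distinct v"
    using assms(1) unfolding strict_sorted_iff .
  then have "card (set v) = card {a..<a + r}"
    using assms(2) by (simp add: distinct_card)
  then have "set v = {a..<a + r}"
    using card_subset_eq[OF _ assms(3)] by blast
  then show "set v = set [a..<a + r]"
    by (simp only: set_upt)
  show "sorted v" "distinct v"
    using sd by blast+
qed (rule sorted_upt distinct_upt)+

lemma gale_chain_full: "gale_chain \<delta> r a r = frag_of [a..<a + r]"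
proof (rule poly_mapping_eqI)
  fix v
  have "length v = r \<and> gale_list \<delta> r a v \<longleftrightarrow> v = [a..<a + r]"
  proof
    assume v: "length v = r \<and> gale_list \<delta> r a v"
    show "v = [a..<a + r]"
      by (rule strict_sorted_eq_upt) (use v gale_list_bounds[of \<delta> r a v] in blast)+
  qed (simp add: gale_list_upt)
  then show "Poly_Mapping.lookup (gale_chain \<delta> r a r) v = Poly_Mapping.lookup (frag_of [a..<a + r]) v"
    unfolding lookup_gale_chain lookup_frag_of by (simp only:)
qed

section \<open>The non-unit cell of an oriental\<close>

text \<open>There are \<open>Suc m\<close> vertices, and degree \<open>k\<close> means lists of
  length \<open>Suc k\<close>. For \<open>m = 2\<close> in degree 1, \<open>Plus\<close> gives
  \<open>[0, 1] + [1, 2]\<close> and \<open>Minus\<close> gives \<open>[0, 2]\<close>.\<close>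

definition oriental_atom :: "nat \<Rightarrow> ocell" where
  "oriental_atom m = (\<lambda>k \<alpha>. gale_chain (\<alpha> = Plus) (Suc m) 0 (Suc k))"

lemma pos_chains_keys:
  "c \<in> pos_chains n k \<Longrightarrow> v \<in> Poly_Mapping.keys c \<Longrightarrow> length v = Suc k \<and> sorted_wrt (<) v \<and> set v \<subseteq> {..n}"
  by (auto simp: pos_chains_def nondeg_simplices_def)

lemma pos_chains_nonneg: "c \<in> pos_chains n k \<Longrightarrow> 0 \<le> Poly_Mapping.lookup c v"
  by (auto simp: pos_chains_def)

text \<open>The boundary of a vertex is the empty list, so \<open>boundary_gale_chain\<close> also
  yields the augmentation of the atom.\<close>

lemma augmentation_eq_eval_boundary:
  assumes "c \<in> pos_chains n 0"
  shows "augmentation c = chain_eval (\<lambda>_. 1) (boundary c)"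
proof -
  have "chain_eval (\<lambda>_. 1) (boundary c) = chain_eval (\<lambda>v. \<Sum>i<length v. (- 1) ^ i * 1) c"
    by (rule chain_eval_boundary) (use pos_chains_keys[OF assms] in auto)
  also have "\<dots> = augmentation c"
    unfolding augmentation_eq_chain_eval chain_eval_def
    by (rule sum.cong) (use pos_chains_keys[OF assms] in auto)
  finally show ?thesis by simp
qed

lemma oriental_atom_pos: "oriental_atom m k \<alpha> \<in> pos_chains m k"
proof -
  have "set v \<subseteq> {..m}" "sorted_wrt (<) v" if "gale_list \<delta> (Suc m) 0 v" for \<delta> v
    using gale_list_bounds[OF that] by auto
  then show ?thesis
    unfolding pos_chains_def nondeg_simplices_def oriental_atom_def
    by (auto simp: keys_gale_chain lookup_gale_chain simp del: gale_list.simps gale_chain.simps)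
qed

lemma oriental_atom_boundary:
  "0 < k \<Longrightarrow> boundary (oriental_atom m k \<alpha>) = oriental_atom m (k - 1) Plus - oriental_atom m (k - 1) Minus"
  by (cases k) (simp_all add: oriental_atom_def boundary_gale_chain del: gale_chain.simps)

lemma oriental_atom_cell: "oriental_atom m \<in> oriental_cells m m"
proof -
  have "augmentation (oriental_atom m 0 \<alpha>) = 1" for \<alpha>
    unfolding augmentation_eq_eval_boundary[OF oriental_atom_pos]
    by (simp add: oriental_atom_def boundary_gale_chain gale_chain_0 chain_eval_diff del: gale_chain.simps)
  moreover have "oriental_atom m m Minus = oriental_atom m m Plus"
    by (simp add: oriental_atom_def gale_chain_full del: gale_chain.simps)
  moreover have "oriental_atom m k \<alpha> = 0" if "k > m" for k \<alpha>
    using that by (simp add: oriental_atom_def gale_chain_eq_0 del: gale_chain.simps)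
  ultimately show ?thesis
    unfolding oriental_cells_def using oriental_atom_pos oriental_atom_boundary by blast
qed

section \<open>Coefficients of a cell after a collapse onto the globe\<close>

definition total_coeff :: "(nat \<Rightarrow> nat) \<Rightarrow> chain \<Rightarrow> int" where
  "total_coeff \<phi> = chain_eval (\<lambda>v. globe_total 0 (map \<phi> v))"

text \<open>For monotone \<open>\<phi>\<close> the list \<open>map \<phi> v\<close> may have
  repeated entries. Both globe functions vanish on such sorted lists, so degenerate images need no
  separate normalization.\<close>

definition atom_coeff :: "(nat \<Rightarrow> nat) \<Rightarrow> chain \<Rightarrow> int" where
  "atom_coeff \<phi> = chain_eval (\<lambda>v. globe_atom 0 (map \<phi> v))"

text \<open>In the globe, the boundary of a cell of degree \<open>Suc k\<close> is the difference of
  the two cells of degree \<open>k\<close>, which occur with opposite signs.\<close>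

lemma coeff_boundary:
  assumes "c \<in> pos_chains n (Suc k)" "mono \<phi>"
  shows "total_coeff \<phi> (boundary c) = 0"
    and "atom_coeff \<phi> (boundary c) = (- 1) ^ Suc k * total_coeff \<phi> c"
proof -
  have keys: "Poly_Mapping.keys c \<subseteq> {v. sorted_wrt (<) v}"
    using pos_chains_keys[OF assms(1)] by auto
  have *: "(\<Sum>i<length v. (- 1) ^ i * globe_total 0 (face i (map \<phi> v))) = 0"
    "(\<Sum>i<length v. (- 1) ^ i * globe_atom 0 (face i (map \<phi> v))) = (- 1) ^ Suc k * globe_total 0 (map \<phi> v)"
    if "v \<in> Poly_Mapping.keys c" for v
  proof -
    have v: "length v = Suc (Suc k)" "sorted v"
      using pos_chains_keys[OF assms(1) that] by (auto simp: strict_sorted_iff)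
    then have "sorted (map \<phi> v)"
      using assms(2) by (simp add: sorted_map monoD sorted_wrt_mono_rel[of _ "(\<le>)"])
    moreover obtain x u where xu: "map \<phi> v = x # u" "length u = Suc k"
      using v(1) by (metis length_Suc_conv length_map)
    ultimately have s: "sorted (x # u)" by simp
    have l: "length v = length (x # u)"
      using v(1) xu(2) by simp
    show "(\<Sum>i<length v. (- 1) ^ i * globe_total 0 (face i (map \<phi> v))) = 0"
      unfolding l xu(1) by (subst sum_faces_globe_total[OF s]) (use xu in auto)
    show "(\<Sum>i<length v. (- 1) ^ i * globe_atom 0 (face i (map \<phi> v))) = (- 1) ^ Suc k * globe_total 0 (map \<phi> v)"
      unfolding l xu(1) by (subst sum_faces_globe_atom[OF s]) (use xu in auto)
  qed
  show "total_coeff \<phi> (boundary c) = 0"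
    unfolding total_coeff_def chain_eval_boundary[OF keys] map_face
    by (simp add: chain_eval_def *)
  show "atom_coeff \<phi> (boundary c) = (- 1) ^ Suc k * total_coeff \<phi> c"
    unfolding total_coeff_def atom_coeff_def chain_eval_boundary[OF keys] map_face
    by (simp add: chain_eval_def * sum_distrib_left mult_ac del: power_Suc)
qed

lemma oriental_cellsD:
  assumes "y \<in> oriental_cells n p"
  shows "y k \<alpha> \<in> pos_chains n k"
    and "p < k \<Longrightarrow> y k \<alpha> = 0"
    and "p \<le> k \<Longrightarrow> y k \<alpha> = y k \<beta>"
    and "k < p \<Longrightarrow> boundary (y (Suc k) \<alpha>) = y k Plus - y k Minus"
    and "augmentation (y 0 \<alpha>) = 1"
proof -
  have 0: "(0 :: chain) \<in> pos_chains n k"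
    by (simp add: pos_chains_def)
  have y: "j \<le> p \<Longrightarrow> y j \<beta> \<in> pos_chains n j" "p < j \<Longrightarrow> y j \<beta> = 0" "y p Minus = y p Plus"
    "0 < j \<Longrightarrow> j \<le> p \<Longrightarrow> boundary (y j \<beta>) = y (j - 1) Plus - y (j - 1) Minus"
    "augmentation (y 0 \<beta>) = 1" for j \<beta>
    using assms by (auto simp: oriental_cells_def)
  show zero: "p < k \<Longrightarrow> y k \<alpha> = 0" for k \<alpha>
    by (rule y)
  show "y k \<alpha> \<in> pos_chains n k"
    using y(1)[of k \<alpha>] zero[of k \<alpha>] 0 by (cases "k \<le> p") auto
  show "p \<le> k \<Longrightarrow> y k \<alpha> = y k \<beta>"
    using y(3) zero[of k] by (cases "p = k"; cases \<alpha>; cases \<beta>) auto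
  show "k < p \<Longrightarrow> boundary (y (Suc k) \<alpha>) = y k Plus - y k Minus"
    using y(4)[of "Suc k"] by simp
  show "augmentation (y 0 \<alpha>) = 1"
    by (rule y)
qed

context
  fixes n p :: nat and y :: ocell and \<phi> :: "nat \<Rightarrow> nat"
  assumes y: "y \<in> oriental_cells n p" and \<phi>: "mono \<phi>"
begin

lemma total_coeff_sign: "total_coeff \<phi> (y k \<alpha>) = total_coeff \<phi> (y k \<beta>)"
proof (cases "k < p")
  case True
  have "total_coeff \<phi> (y k Plus) = total_coeff \<phi> (y k Minus)"
    using coeff_boundary(1)[OF oriental_cellsD(1)[OF y, of "Suc k" Plus] \<phi>] oriental_cellsD(4)[OF y True]
    by (simp add: total_coeff_def chain_eval_diff)
  then show ?thesis
    by (cases \<alpha>; cases \<beta>) auto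
next
  case False
  then show ?thesis
    using oriental_cellsD(3)[OF y, of k \<alpha> \<beta>] by simp
qed

lemma total_coeff_0: "total_coeff \<phi> (y 0 \<alpha>) = 1"
proof -
  have "globe_total 0 (map \<phi> v) = 1" if "v \<in> Poly_Mapping.keys (y 0 \<alpha>)" for v
    using pos_chains_keys[OF oriental_cellsD(1)[OF y] that] by (auto simp: length_Suc_conv)
  then have "total_coeff \<phi> (y 0 \<alpha>) = augmentation (y 0 \<alpha>)"
    by (simp add: total_coeff_def augmentation_def chain_eval_def)
  then show ?thesis
    using oriental_cellsD(5)[OF y] by simp
qed

lemma atom_coeff_diff:
  "atom_coeff \<phi> (y k Plus) - atom_coeff \<phi> (y k Minus) = (- 1) ^ Suc k * total_coeff \<phi> (y (Suc k) \<alpha>)"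
proof (cases "k < p")
  case True
  then show ?thesis
    using coeff_boundary(2)[OF oriental_cellsD(1)[OF y, of "Suc k" \<alpha>] \<phi>] oriental_cellsD(4)[OF y True, of \<alpha>]
    by (simp add: atom_coeff_def chain_eval_diff)
next
  case False
  then show ?thesis
    using oriental_cellsD(3)[OF y, of k Plus Minus] oriental_cellsD(2)[OF y, of "Suc k" \<alpha>]
    by (simp add: total_coeff_def)
qed

lemma atom_coeff_nonneg: "0 \<le> atom_coeff \<phi> (y k \<alpha>)"
  unfolding atom_coeff_def chain_eval_def
  by (intro sum_nonneg mult_nonneg_nonneg globe_atom_nonneg pos_chains_nonneg[OF oriental_cellsD(1)[OF y]])

lemma atom_coeff_le_total: "atom_coeff \<phi> (y k \<alpha>) \<le> total_coeff \<phi> (y k \<alpha>)"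
  unfolding atom_coeff_def total_coeff_def
proof (rule chain_eval_mono)
  show "0 \<le> Poly_Mapping.lookup (y k \<alpha>) v" for v
    using pos_chains_nonneg[OF oriental_cellsD(1)[OF y]] .
  show "globe_atom 0 (map \<phi> v) \<le> globe_total 0 (map \<phi> v)" if "v \<in> Poly_Mapping.keys (y k \<alpha>)" for v
    using pos_chains_keys[OF oriental_cellsD(1)[OF y] that] by (auto intro: globe_atom_le_total)
qed

lemma total_coeff_nonneg: "0 \<le> total_coeff \<phi> (y k \<alpha>)"
  using atom_coeff_nonneg atom_coeff_le_total by (rule order_trans)

text \<open>The two atom coefficients in degree \<open>k\<close> lie between 0 and the total
  coefficient there, and their difference is, up to sign, the total coefficient in degree
  \<open>Suc k\<close>. As the total is 1 in degree 0, all totals are then 0 or 1.\<close>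

lemma total_coeff_Suc_le: "total_coeff \<phi> (y (Suc k) \<alpha>) \<le> total_coeff \<phi> (y k \<beta>)"
proof -
  have "\<bar>(- 1) ^ Suc k * total_coeff \<phi> (y (Suc k) \<alpha>)\<bar> \<le> total_coeff \<phi> (y k \<beta>)"
    using atom_coeff_nonneg[of k Plus] atom_coeff_nonneg[of k Minus]
      atom_coeff_le_total[of k Plus] atom_coeff_le_total[of k Minus]
      total_coeff_sign[of k Plus \<beta>] total_coeff_sign[of k Minus \<beta>]
    unfolding atom_coeff_diff[of k \<alpha>, symmetric] by linarith
  then show ?thesis
    using total_coeff_nonneg[of "Suc k" \<alpha>] by (simp add: abs_mult power_abs)
qed

lemma total_coeff_antimono: "k \<le> l \<Longrightarrow> total_coeff \<phi> (y l \<alpha>) \<le> total_coeff \<phi> (y k \<alpha>)"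
  by (rule lift_Suc_antimono_le[of "\<lambda>k. total_coeff \<phi> (y k \<alpha>)"]) (rule total_coeff_Suc_le)

lemma total_coeff_cases: "total_coeff \<phi> (y k \<alpha>) = 0 \<or> total_coeff \<phi> (y k \<alpha>) = 1"
  using total_coeff_antimono[of 0 k \<alpha>] total_coeff_nonneg[of k \<alpha>] total_coeff_0[of \<alpha>] by linarith

end

section \<open>Collapses sending a given simplex to the full simplex\<close>

lemma collapse_strict_sorted:
  fixes w :: "nat list"
  assumes "sorted_wrt (<) (x # w)"
  shows "map (\<lambda>i. b + length (filter (\<lambda>z. z \<le> i) w)) (x # w) = [b..<Suc (b + length w)]"
  using assms
proof (induction w arbitrary: x b)
  case (Cons y w)
  have "filter (\<lambda>z. z \<le> x) (y # w) = []"
    using Cons.prems by (auto simp: filter_empty_conv not_le)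
  moreover have "y \<le> i" if "i \<in> set (y # w)" for i
    using Cons.prems that by auto
  ultimately have "map (\<lambda>i. b + length (filter (\<lambda>z. z \<le> i) (y # w))) (x # y # w) =
    b # map (\<lambda>i. Suc b + length (filter (\<lambda>z. z \<le> i) w)) (y # w)"
    by simp
  also have "\<dots> = b # [Suc b..<Suc (Suc b + length w)]"
    by (subst Cons.IH) (use Cons.prems in auto)
  also have "\<dots> = [b..<Suc (b + length (y # w))]"
    by (simp add: upt_conv_Cons del: upt_Suc)
  finally show ?case .
qed simp

lemma length_filter_le_Suc:
  assumes "distinct w"
  shows "length (filter (\<lambda>z. z \<le> Suc i) w) \<le> Suc (length (filter (\<lambda>z. z \<le> i) w))"
proof -
  have *: "length (filter P w) = card {z \<in> set w. P z}" for P
    using assms by (metis distinct_card distinct_filter set_filter)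
  have "card {z \<in> set w. z \<le> Suc i} \<le> card (insert (Suc i) {z \<in> set w. z \<le> i})"
    by (rule card_mono) auto
  then show ?thesis
    unfolding * by (simp add: card_insert_if split: if_splits)
qed

text \<open>The map \<open>\<phi>\<close> jumps by 1 at each vertex of \<open>v\<close> except the
  first, and \<open>gale_list_transversal\<close> picks \<open>u\<close> with one vertex in each of
  the \<open>k + 1\<close> fibres. Thus \<open>v\<close> and a simplex of the atom get the same
  image.\<close>

lemma gale_list_collapse:
  assumes v: "sorted_wrt (<) v" "length v = Suc k" "set v \<subseteq> {..m}"
  obtains \<phi> u where "mono \<phi>" "map \<phi> v = [0..<Suc k]" "gale_list \<delta> (Suc m) 0 u" "map \<phi> u = [0..<Suc k]"
proof -
  obtain x w where xw: "v = x # w" "length w = k"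
    using v(2) by (metis length_Suc_conv)
  define \<phi> where "\<phi> = (\<lambda>i. length (filter (\<lambda>z. z \<le> i) w))"
  have step: "\<phi> i \<le> \<phi> (Suc i)" "\<phi> (Suc i) \<le> Suc (\<phi> i)" for i
  proof -
    show "\<phi> i \<le> \<phi> (Suc i)"
      unfolding \<phi>_def by (induction w) auto
    show "\<phi> (Suc i) \<le> Suc (\<phi> i)"
      unfolding \<phi>_def using v(1) by (intro length_filter_le_Suc) (simp add: xw strict_sorted_iff)
  qed
  have "\<phi> 0 = 0"
    using v(1) by (auto simp: \<phi>_def xw filter_empty_conv)
  moreover have "\<phi> (0 + m) = k"
    using v(3) xw by (auto simp: \<phi>_def subset_iff)
  ultimately obtain u where "gale_list \<delta> (Suc m) 0 u" "map \<phi> u = [0..<Suc k]"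
    using gale_list_transversal(1)[of \<phi> \<delta> m 0] step by metis
  moreover have "map \<phi> v = [0..<Suc k]"
    using collapse_strict_sorted[of x w 0] v(1) by (simp add: xw \<phi>_def del: upt_Suc)
  moreover have "mono \<phi>"
    using step(1) by (simp add: mono_iff_le_Suc)
  ultimately show ?thesis
    using that by blast
qed

lemma chain_eval_ge:
  assumes "\<And>v. 0 \<le> Poly_Mapping.lookup c v" "\<And>v. 0 \<le> h v"
  shows "Poly_Mapping.lookup c v * h v \<le> chain_eval h c"
proof -
  have "chain_eval h c = (\<Sum>u\<in>insert v (Poly_Mapping.keys c). Poly_Mapping.lookup c u * h u)"
    by (rule chain_eval_superset) auto
  then show ?thesis
    using member_le_sum[of v "insert v (Poly_Mapping.keys c)" "\<lambda>u. Poly_Mapping.lookup c u * h u"] assms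
    by simp
qed

lemma mono_ident: "mono (\<lambda>i::nat. i)"
  by (simp add: mono_def)

text \<open>Downward induction on the degree. The top entry is a nonzero multiple of the full
  simplex with coefficient at most 1. Below, \<open>y\<close> and the atom have the same difference
  of signs, and the two entries of the atom have disjoint supports, so \<open>y\<close> dominates
  the atom; a surplus simplex would force a total coefficient of at least 2.\<close>

lemma oriental_cell_eq_atom:
  assumes y: "y \<in> oriental_cells m m" and nz: "y m Plus \<noteq> 0"
  shows "y = oriental_atom m"
proof -
  have top: "y m \<alpha> = oriental_atom m m \<alpha>" for \<alpha>
  proof -
    have keys: "Poly_Mapping.keys (y m Plus) \<subseteq> {[0..<Suc m]}"
    proof
      fix v assume "v \<in> Poly_Mapping.keys (y m Plus)"
      from pos_chains_keys[OF oriental_cellsD(1)[OF y] this]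
      have "v = [0..<0 + Suc m]"
        by (intro strict_sorted_eq_upt) (auto simp: subset_iff less_Suc_eq_le)
      then show "v \<in> {[0..<Suc m]}"
        by simp
    qed
    define c where "c = Poly_Mapping.lookup (y m Plus) [0..<Suc m]"
    have c: "y m Plus = frag_cmul c (frag_of [0..<Suc m])"
    proof (rule poly_mapping_eqI)
      fix v
      show "Poly_Mapping.lookup (y m Plus) v = Poly_Mapping.lookup (frag_cmul c (frag_of [0..<Suc m])) v"
        using keys by (cases "v = [0..<Suc m]") (auto simp: c_def in_keys_iff)
    qed
    have "globe_atom 0 [0..<Suc m] = 1"
      using globe_atom_upt[of 0 "Suc m"] by simp
    then have "atom_coeff (\<lambda>i. i) (y m Plus) = c"
      by (simp add: c atom_coeff_def chain_eval_cmul del: upt_Suc)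
    moreover have "c \<noteq> 0"
      using c nz by auto
    ultimately have "c = 1"
      using atom_coeff_nonneg[OF y mono_ident, of m Plus] atom_coeff_le_total[OF y mono_ident, of m Plus]
        total_coeff_cases[OF y mono_ident, of m Plus] by linarith
    then show ?thesis
      using c oriental_cellsD(3)[OF y, of m \<alpha> Plus]
      by (simp add: oriental_atom_def gale_chain_full del: upt_Suc gale_chain.simps)
  qed
  have "\<forall>\<alpha>. y k \<alpha> = oriental_atom m k \<alpha>" if "k \<le> m" for k
    using that
  proof (induction k rule: inc_induct)
    case base
    show ?case using top by blast
  next
    case (step k)
    let ?x = "oriental_atom m"
    have diff: "y k Plus - y k Minus = ?x k Plus - ?x k Minus"
      using oriental_cellsD(4)[OF y, of k Plus] oriental_atom_boundary[of "Suc k" m Plus] step by simp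
    then have diff': "Poly_Mapping.lookup (y k Plus) v - Poly_Mapping.lookup (y k Minus) v =
        Poly_Mapping.lookup (?x k Plus) v - Poly_Mapping.lookup (?x k Minus) v" for v
      by (metis lookup_minus)
    have ge: "Poly_Mapping.lookup (?x k \<alpha>) v \<le> Poly_Mapping.lookup (y k \<alpha>) v" for \<alpha> v
    proof -
      \<comment> \<open>A list accepted under both flags has all \<open>Suc m\<close> vertices,
        whereas \<open>k < m\<close>.\<close>
      have "\<not> (gale_list True (Suc m) 0 v \<and> gale_list False (Suc m) 0 v)" if "length v = Suc k"
        using gale_list_disjoint[of "Suc m" 0 v] that step by auto
      then have "Poly_Mapping.lookup (?x k Plus) v = 0 \<or> Poly_Mapping.lookup (?x k Minus) v = 0"
        by (auto simp: oriental_atom_def lookup_gale_chain simp del: gale_list.simps gale_chain.simps)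
      then have "Poly_Mapping.lookup (?x k Plus) v \<le> Poly_Mapping.lookup (y k Plus) v \<and>
          Poly_Mapping.lookup (?x k Minus) v \<le> Poly_Mapping.lookup (y k Minus) v"
        using diff'[of v] pos_chains_nonneg[OF oriental_cellsD(1)[OF y], of k Plus v]
          pos_chains_nonneg[OF oriental_cellsD(1)[OF y], of k Minus v] by linarith
      then show ?thesis
        by (cases \<alpha>) blast+
    qed
    show ?case
    proof (intro allI poly_mapping_eqI)
      fix \<alpha> v
      show "Poly_Mapping.lookup (y k \<alpha>) v = Poly_Mapping.lookup (?x k \<alpha>) v"
      proof (rule ccontr)
        assume "Poly_Mapping.lookup (y k \<alpha>) v \<noteq> Poly_Mapping.lookup (?x k \<alpha>) v"
        then have less: "Poly_Mapping.lookup (?x k \<alpha>) v < Poly_Mapping.lookup (y k \<alpha>) v"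
          using ge[of \<alpha> v] by linarith
        then have "v \<in> Poly_Mapping.keys (y k \<alpha>)"
          using pos_chains_nonneg[OF oriental_atom_pos, of m k \<alpha> v] by (auto simp: in_keys_iff)
        \<comment> \<open>Under this collapse the atom contributes at least 1 through
          \<open>u\<close>, and the surplus of \<open>y\<close> over the atom at least another 1
          through \<open>v\<close>.\<close>
        from pos_chains_keys[OF oriental_cellsD(1)[OF y] this]
        obtain \<phi> u where \<phi>: "mono \<phi>" "map \<phi> v = [0..<Suc k]"
          and u: "gale_list (\<alpha> = Plus) (Suc m) 0 u" "map \<phi> u = [0..<Suc k]"
          using gale_list_collapse[of v k m "\<alpha> = Plus"] by blast
        have one: "globe_atom 0 [0..<Suc k] = 1"
          using globe_atom_upt[of 0 "Suc k"] by simp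
        have "length u = Suc k"
          using arg_cong[OF u(2), of length] by simp
        then have "Poly_Mapping.lookup (?x k \<alpha>) u * globe_atom 0 (map \<phi> u) = 1"
          using u one by (simp add: oriental_atom_def lookup_gale_chain del: upt_Suc gale_list.simps gale_chain.simps)
        then have 1: "1 \<le> atom_coeff \<phi> (?x k \<alpha>)"
          using chain_eval_ge[of "?x k \<alpha>" "\<lambda>v. globe_atom 0 (map \<phi> v)" u]
            pos_chains_nonneg[OF oriental_atom_pos] globe_atom_nonneg
          by (simp add: atom_coeff_def)
        have "Poly_Mapping.lookup (y k \<alpha> - ?x k \<alpha>) v * globe_atom 0 (map \<phi> v) \<le> atom_coeff \<phi> (y k \<alpha> - ?x k \<alpha>)"
          unfolding atom_coeff_def
          by (rule chain_eval_ge) (use ge globe_atom_nonneg in \<open>auto simp: lookup_minus\<close>)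
        then have "1 \<le> atom_coeff \<phi> (y k \<alpha>) - atom_coeff \<phi> (?x k \<alpha>)"
          using less one \<phi> by (simp add: lookup_minus atom_coeff_def chain_eval_diff del: upt_Suc)
        with 1 have "2 \<le> total_coeff \<phi> (y k \<alpha>)"
          using atom_coeff_le_total[OF y \<phi>(1), of k \<alpha>] by linarith
        then show False
          using total_coeff_cases[OF y \<phi>(1), of k \<alpha>] by linarith
      qed
    qed
  qed
  moreover have "y k \<alpha> = oriental_atom m k \<alpha>" if "m < k" for k \<alpha>
    using oriental_cellsD(2)[OF y that] oriental_cellsD(2)[OF oriental_atom_cell that] by simp
  ultimately show ?thesis
    by (intro ext) (metis not_le)
qed

text \<open>If the top entry vanishes, the boundary equation makes the two entries one degree lower
  equal, so the family is already a cell of dimension \<open>p - 1\<close>. In dimension 0 the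
  augmentation excludes this.\<close>

lemma is_unit_cell_oriental_iff:
  assumes y: "y \<in> oriental_cells n p"
  shows "is_unit_cell (oriental n) p y \<longleftrightarrow> y p Plus = 0"
proof
  assume "is_unit_cell (oriental n) p y"
  then show "y p Plus = 0"
    using oriental_cellsD(2) by (auto simp: is_unit_cell_def oriental_def)
next
  assume zero: "y p Plus = 0"
  have "p \<noteq> 0"
  proof
    assume "p = 0"
    then have "augmentation (y 0 Plus) = 0"
      using zero by (simp add: augmentation_def)
    then show False
      using oriental_cellsD(5)[OF y, of Plus] by simp
  qed
  then obtain q where q: "p = Suc q"
    by (cases p) auto
  have pz: "y p \<alpha> = 0" for \<alpha>
    using zero oriental_cellsD(3)[OF y, of p \<alpha> Plus] by simp
  have "y q Minus = y q Plus"
    using oriental_cellsD(4)[OF y, of q Plus] pz q by simp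
  moreover have "y k \<alpha> = 0" if "q < k" for k \<alpha>
    using that q pz oriental_cellsD(2)[OF y, of k \<alpha>] by (cases "k = p") auto
  ultimately have "y \<in> oriental_cells n q"
    using y unfolding oriental_cells_def q by auto
  then show "is_unit_cell (oriental n) p y"
    using q by (auto simp: is_unit_cell_def oriental_def)
qed

lemma oriental_top_eq_atom: "oriental_top m = oriental_atom m"
proof -
  have "oriental_atom m m Plus \<noteq> 0"
    by (simp add: oriental_atom_def gale_chain_full del: upt_Suc gale_chain.simps)
  then show ?thesis
    unfolding oriental_top_def
    by (intro the_equality)
       (auto simp: oriental_def is_unit_cell_oriental_iff[unfolded oriental_def] oriental_atom_cell
         intro: oriental_cell_eq_atom)
qed

section \<open>The functor from an oriental to a cell\<close>

lemma pos_chains_add: "c \<in> pos_chains n k \<Longrightarrow> d \<in> pos_chains n k \<Longrightarrow> c + d \<in> pos_chains n k"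
  using Poly_Mapping.keys_add[of c d] by (auto simp: pos_chains_def lookup_add)

lemma pos_chains_eq_0:
  assumes "c \<in> pos_chains n k" "n < k"
  shows "c = 0"
proof -
  have False if "v \<in> Poly_Mapping.keys c" for v
  proof -
    have v: "length v = Suc k" "distinct v" "set v \<subseteq> {..n}"
      using pos_chains_keys[OF assms(1) that] by (auto simp: strict_sorted_iff)
    then have "Suc k \<le> card {..n}"
      by (metis card_mono distinct_card finite_atMost)
    with assms(2) show False by simp
  qed
  then show ?thesis
    using keys_eq_empty by blast
qed

lemma oriental_cellsI:
  assumes "\<And>k \<alpha>. y k \<alpha> \<in> pos_chains n k"
    and "\<And>k \<alpha>. p < k \<Longrightarrow> y k \<alpha> = 0"
    and "y p Minus = y p Plus"
    and "\<And>k \<alpha>. k < p \<Longrightarrow> boundary (y (Suc k) \<alpha>) = y k Plus - y k Minus"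
    and "\<And>\<alpha>. augmentation (y 0 \<alpha>) = 1"
  shows "y \<in> oriental_cells n p"
proof -
  have "boundary (y k \<alpha>) = y (k - 1) Plus - y (k - 1) Minus" if "0 < k" "k \<le> p" for k \<alpha>
    using assms(4)[of "k - 1" \<alpha>] that by simp
  then show ?thesis
    using assms by (auto simp: oriental_cells_def)
qed

lemma oriental_bd_cell:
  assumes "y \<in> oriental_cells n p" "k < p"
  shows "oriental_bd \<alpha> k y \<in> oriental_cells n k"
proof (rule oriental_cellsI)
  show "oriental_bd \<alpha> k y j \<beta> \<in> pos_chains n j" for j \<beta>
    using oriental_cellsD(1)[OF assms(1)] by (auto simp: oriental_bd_def pos_chains_def)
  show "augmentation (oriental_bd \<alpha> k y 0 \<beta>) = 1" for \<beta>
    using oriental_cellsD(5)[OF assms(1)] by (auto simp: oriental_bd_def)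
  show "boundary (oriental_bd \<alpha> k y (Suc j) \<beta>) = oriental_bd \<alpha> k y j Plus - oriental_bd \<alpha> k y j Minus"
    if "j < k" for j \<beta>
    using oriental_cellsD(4)[OF assms(1), of j] that assms(2)
    by (cases "Suc j = k") (auto simp: oriental_bd_def)
qed (auto simp: oriental_bd_def)

lemma oriental_one_cell:
  assumes "y \<in> oriental_cells n p" "p < q"
  shows "y \<in> oriental_cells n q"
proof (rule oriental_cellsI)
  show "boundary (y (Suc k) \<alpha>) = y k Plus - y k Minus" for k \<alpha>
    using oriental_cellsD(4)[OF assms(1), of k \<alpha>] oriental_cellsD(2)[OF assms(1), of "Suc k" \<alpha>]
      oriental_cellsD(3)[OF assms(1), of k Plus Minus] by (cases "k < p") auto
qed (use assms oriental_cellsD[OF assms(1)] in auto)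

lemma oriental_simps [simp]:
  "Cells (oriental n) = oriental_cells n"
  "bd (oriental n) \<alpha> p k = oriental_bd \<alpha> k"
  "one (oriental n) p q y = y"
  by (simp_all add: oriental_def)

lemma oriental_bd_apply:
  "oriental_bd \<alpha> k y j \<beta> = (if j < k then y j \<beta> else if j = k then y k \<alpha> else 0)"
  by (simp add: oriental_bd_def)

lemma composable_orientalD:
  assumes "composable (oriental n) p k y z"
  shows "k < p" "y \<in> oriental_cells n p" "z \<in> oriental_cells n p"
    and "j < k \<Longrightarrow> y j \<beta> = z j \<beta>" and "y k Minus = z k Plus"
proof -
  have eq: "oriental_bd Minus k y = oriental_bd Plus k z"
    and *: "k < p" "y \<in> oriental_cells n p" "z \<in> oriental_cells n p"
    using assms by (auto simp: composable_def)
  show "k < p" "y \<in> oriental_cells n p" "z \<in> oriental_cells n p"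
    using * by auto
  show "j < k \<Longrightarrow> y j \<beta> = z j \<beta>"
    using fun_cong[OF fun_cong[OF eq], of j \<beta>] by (simp add: oriental_bd_apply)
  show "y k Minus = z k Plus"
    using fun_cong[OF fun_cong[OF eq], of k Plus] by (simp add: oriental_bd_apply)
qed

text \<open>In degree \<open>k\<close> the common boundary cancels, leaving the source of
  \<open>z\<close> and the target of \<open>y\<close>.\<close>

lemma oriental_cmp_apply:
  assumes "composable (oriental n) p k y z"
  shows "cmp (oriental n) p k y z j \<beta> =
    (if j < k then z j \<beta>
     else if j = k then (if \<beta> = Minus then z k Minus else y k Plus)
     else y j \<beta> + z j \<beta>)"
  using composable_orientalD(5)[OF assms]
  by (cases \<beta>) (auto simp: oriental_def oriental_bd_apply)

lemma oriental_cmp_cell: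
  assumes "composable (oriental n) p k y z"
  shows "cmp (oriental n) p k y z \<in> oriental_cells n p"
proof (rule oriental_cellsI)
  note c = composable_orientalD[OF assms]
  note app = oriental_cmp_apply[OF assms]
  note dy = oriental_cellsD[OF c(2)] and dz = oriental_cellsD[OF c(3)]
  show "cmp (oriental n) p k y z j \<beta> \<in> pos_chains n j" for j \<beta>
    using dy(1) dz(1) by (auto simp: app intro: pos_chains_add)
  show "cmp (oriental n) p k y z j \<beta> = 0" if "p < j" for j \<beta>
    using that c(1) dy(2) dz(2) by (auto simp: app)
  show "cmp (oriental n) p k y z p Minus = cmp (oriental n) p k y z p Plus"
    using c(1) dy(3)[of p Minus Plus] dz(3)[of p Minus Plus] by (auto simp: app)
  show "augmentation (cmp (oriental n) p k y z 0 \<beta>) = 1" for \<beta>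
    using dy(5) dz(5) by (auto simp: app)
  show "boundary (cmp (oriental n) p k y z (Suc j) \<beta>) =
      cmp (oriental n) p k y z j Plus - cmp (oriental n) p k y z j Minus" if "j < p" for j \<beta>
  proof -
    consider "Suc j < k" | "Suc j = k" | "j = k" | "k < j" by linarith
    then show ?thesis
    proof cases
      case 2
      then show ?thesis
        using dy(4)[OF that, of Plus] dz(4)[OF that, of Minus] c(4)[of j] by (auto simp: app)
    qed (use c(5) dy(4)[OF that, of \<beta>] dz(4)[OF that, of \<beta>] in \<open>auto simp: app boundary_add\<close>)
  qed
qed

section \<open>The image of a cell in the globe\<close>

abbreviation id_total :: "chain \<Rightarrow> int" where
  "id_total \<equiv> total_coeff (\<lambda>i. i)"

abbreviation id_atom :: "chain \<Rightarrow> int" where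
  "id_atom \<equiv> atom_coeff (\<lambda>i. i)"

text \<open>The dimension of the image of \<open>y\<close> in the globe, with units stripped. Degree
  0 always has total coefficient 1, so the search starts in degree 1.\<close>

definition globe_dim :: "ocell \<Rightarrow> nat" where
  "globe_dim y = (LEAST k. id_total (y (Suc k) Plus) = 0)"

text \<open>The parity condition reflects that the face opposite to the last vertex has sign \<open>(-1)\<^sup>k\<close>.\<close>

definition globe_sign :: "nat \<Rightarrow> chain \<Rightarrow> sign" where
  "globe_sign k c = (if id_atom c = of_bool (odd k) then Plus else Minus)"

lemma coeff_zero [simp]: "total_coeff \<phi> 0 = 0" "atom_coeff \<phi> 0 = 0"
  by (simp_all add: total_coeff_def atom_coeff_def)

lemma coeff_add:
  "total_coeff \<phi> (c + d) = total_coeff \<phi> c + total_coeff \<phi> d"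
  "atom_coeff \<phi> (c + d) = atom_coeff \<phi> c + atom_coeff \<phi> d"
  by (simp_all add: total_coeff_def atom_coeff_def chain_eval_add)

context
  fixes n p :: nat and y :: ocell
  assumes y: "y \<in> oriental_cells n p"
begin

lemma total_eq_iff_le_globe_dim: "id_total (y k \<alpha>) = of_bool (k \<le> globe_dim y)"
proof -
  note cases = total_coeff_cases[OF y mono_ident]
  have z: "id_total (y (Suc (globe_dim y)) Plus) = 0"
    unfolding globe_dim_def
    by (rule LeastI[of _ p]) (simp add: oriental_cellsD(2)[OF y])
  have "id_total (y k Plus) = 1" if "k \<le> globe_dim y"
  proof (cases k)
    case 0
    then show ?thesis using total_coeff_0[OF y mono_ident] by simp
  next
    case (Suc l)
    then have "id_total (y (Suc l) Plus) \<noteq> 0"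
      using that not_less_Least[of l "\<lambda>k. id_total (y (Suc k) Plus) = 0"]
      unfolding globe_dim_def by (simp add: Suc_le_eq)
    then show ?thesis
      using cases[of k Plus] Suc by simp
  qed
  moreover have "id_total (y k Plus) = 0" if "\<not> k \<le> globe_dim y"
    using total_coeff_antimono[OF y mono_ident, of "Suc (globe_dim y)" k Plus] that z cases[of k Plus] by auto
  ultimately show ?thesis
    using total_coeff_sign[OF y mono_ident, of k \<alpha> Plus] by auto
qed

lemma globe_dim_le: "globe_dim y \<le> p" "globe_dim y \<le> n"
proof -
  have 1: "id_total (y (globe_dim y) Plus) = 1"
    by (simp add: total_eq_iff_le_globe_dim)
  then show "globe_dim y \<le> p"
    using oriental_cellsD(2)[OF y, of "globe_dim y" Plus] by (cases "p < globe_dim y") auto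
  show "globe_dim y \<le> n"
    using 1 pos_chains_eq_0[OF oriental_cellsD(1)[OF y], of "globe_dim y" Plus]
    by (cases "n < globe_dim y") auto
qed

text \<open>Below the dimension of the image the two atom coefficients are 0 and 1, in an order
  fixed by the parity of \<open>k\<close>.\<close>

lemma globe_sign_less: "k < globe_dim y \<Longrightarrow> globe_sign k (y k \<alpha>) = \<alpha>"
  using atom_coeff_diff[OF y mono_ident, of k Plus]
    atom_coeff_nonneg[OF y mono_ident, of k Plus] atom_coeff_nonneg[OF y mono_ident, of k Minus]
    atom_coeff_le_total[OF y mono_ident, of k Plus] atom_coeff_le_total[OF y mono_ident, of k Minus]
  by (cases \<alpha>; cases "odd k") (auto simp: globe_sign_def total_eq_iff_le_globe_dim)

text \<open>In the top degree of the image the entries may differ but their images agree, so reading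
  off \<open>Plus\<close> in \<open>globe_functor\<close> is no real choice.\<close>

lemma atom_globe_dim: "id_atom (y (globe_dim y) \<alpha>) = id_atom (y (globe_dim y) \<beta>)"
proof -
  have "id_atom (y (globe_dim y) Plus) = id_atom (y (globe_dim y) Minus)"
    using atom_coeff_diff[OF y mono_ident, of "globe_dim y" Plus]
    by (simp add: total_eq_iff_le_globe_dim)
  then show ?thesis
    by (cases \<alpha>; cases \<beta>) auto
qed

lemma atom_eq_0: "globe_dim y < k \<Longrightarrow> id_atom (y k \<alpha>) = 0"
  using atom_coeff_nonneg[OF y mono_ident, of k \<alpha>] atom_coeff_le_total[OF y mono_ident, of k \<alpha>]
  by (simp add: total_eq_iff_le_globe_dim)

end

lemma globe_dim_eqI:
  assumes "\<And>k. id_total (y (Suc k) Plus) = of_bool (Suc k \<le> d)"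
  shows "globe_dim y = d"
  unfolding globe_dim_def assms by (rule Least_equality) auto

section \<open>Extending a cell to a functor on the oriental\<close>

definition bd_le :: "'a omega_cat \<Rightarrow> sign \<Rightarrow> nat \<Rightarrow> nat \<Rightarrow> 'a \<Rightarrow> 'a" where
  "bd_le C \<alpha> n k c = (if k = n then c else bd C \<alpha> n k c)"

text \<open>The axioms constrain \<open>bd\<close> and \<open>one\<close> only between different
  dimensions; \<open>bd_le\<close> and \<open>one_le\<close> add the identity for equal
  ones.\<close>

definition one_le :: "'a omega_cat \<Rightarrow> nat \<Rightarrow> nat \<Rightarrow> 'a \<Rightarrow> 'a" where
  "one_le C n m c = (if n = m then c else one C n m c)"

text \<open>The collapse followed by the functor from the \<open>m\<close>-globe that picks out
  \<open>x\<close>. In dimension \<open>m\<close> the sign is ignored, since \<open>bd_le\<close>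
  then returns \<open>x\<close>.\<close>

definition globe_functor :: "'a omega_cat \<Rightarrow> nat \<Rightarrow> 'a \<Rightarrow> nat \<Rightarrow> ocell \<Rightarrow> 'a" where
  "globe_functor C m x p y =
     one_le C (globe_dim y) p
       (bd_le C (globe_sign (globe_dim y) (y (globe_dim y) Plus)) m (globe_dim y) x)"

lemma globe_functor_cong:
  assumes "globe_dim w = globe_dim y"
    and "id_atom (w (globe_dim y) Plus) = id_atom (y (globe_dim y) Plus)"
  shows "globe_functor C m x p w = globe_functor C m x p y"
  using assms by (simp add: globe_functor_def globe_sign_def)

context omega_category
begin

lemma bd_le_cell: "k \<le> n \<Longrightarrow> c \<in> Cells C n \<Longrightarrow> bd_le C \<alpha> n k c \<in> Cells C k"
  by (auto simp: bd_le_def bd_cell)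

lemma one_le_cell: "n \<le> m \<Longrightarrow> c \<in> Cells C n \<Longrightarrow> one_le C n m c \<in> Cells C m"
  by (auto simp: one_le_def one_cell)

lemma bd_bd_le: "k < s \<Longrightarrow> s \<le> n \<Longrightarrow> c \<in> Cells C n \<Longrightarrow> bd C \<alpha> s k (bd_le C \<beta> n s c) = bd C \<alpha> n k c"
  by (auto simp: bd_le_def globular)

lemma bd_one_le:
  assumes "s \<le> p" "k < p" "c \<in> Cells C s"
  shows "bd C \<alpha> p k (one_le C s p c) = (if s \<le> k then one_le C s k c else bd C \<alpha> s k c)"
  using assms by (auto simp: one_le_def bd_one_less bd_one_eq bd_one_greater)

lemma one_one_le:
  assumes "s \<le> n" "n < m" "c \<in> Cells C s"
  shows "one C n m (one_le C s n c) = one_le C s m c"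
  using assms by (auto simp: one_le_def one_one)

context
  fixes m :: nat and x :: 'a
  assumes x: "x \<in> Cells C m"
begin

abbreviation "G \<equiv> globe_functor C m x"

lemma globe_functor_cell: "y \<in> oriental_cells m p \<Longrightarrow> G p y \<in> Cells C p"
  unfolding globe_functor_def by (intro one_le_cell bd_le_cell globe_dim_le x)

lemma globe_dim_bd:
  assumes y: "y \<in> oriental_cells m p"
  shows "globe_dim (oriental_bd \<alpha> k y) = min (globe_dim y) k"
  by (rule globe_dim_eqI) (auto simp: oriental_bd_apply total_eq_iff_le_globe_dim[OF y])

lemma globe_functor_bd_small:
  assumes y: "y \<in> oriental_cells m p" and "globe_dim y \<le> k"
  shows "G k (oriental_bd \<alpha> k y) = G k y"
  by (rule globe_functor_cong)
     (use assms(2) atom_globe_dim[OF y] in \<open>auto simp: globe_dim_bd[OF y] oriental_bd_apply\<close>)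

lemma globe_functor_bd:
  assumes y: "y \<in> oriental_cells m p" and "k < p"
  shows "G k (oriental_bd \<alpha> k y) = bd C \<alpha> p k (G p y)"
proof -
  let ?s = "globe_dim y"
  define c where "c = bd_le C (globe_sign ?s (y ?s Plus)) m ?s x"
  have c: "c \<in> Cells C ?s"
    unfolding c_def by (intro bd_le_cell globe_dim_le[OF y] x)
  have G: "G q y = one_le C ?s q c" for q
    by (simp add: globe_functor_def c_def)
  show ?thesis
  proof (cases "?s \<le> k")
    case True
    then show ?thesis
      using globe_functor_bd_small[OF y] bd_one_le[OF globe_dim_le(1)[OF y] assms(2) c] by (simp add: G)
  next
    case False
    then have d: "globe_dim (oriental_bd \<alpha> k y) = k" and "k < ?s"
      by (auto simp: globe_dim_bd[OF y])
    moreover have "?s \<le> m"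
      using globe_dim_le[OF y] by simp
    ultimately have "G k (oriental_bd \<alpha> k y) = bd C \<alpha> m k x"
      unfolding globe_functor_def d
      by (simp add: one_le_def bd_le_def oriental_bd_apply globe_sign_less[OF y])
    also have "\<dots> = bd C \<alpha> ?s k c"
      unfolding c_def using \<open>k < ?s\<close> \<open>?s \<le> m\<close> x by (simp add: bd_bd_le)
    also have "\<dots> = bd C \<alpha> p k (G p y)"
      using bd_one_le[OF globe_dim_le(1)[OF y] assms(2) c] False by (simp add: G)
    finally show ?thesis .
  qed
qed

lemma globe_functor_one:
  assumes y: "y \<in> oriental_cells m p" and "p < q"
  shows "G q y = one C p q (G p y)"
  unfolding globe_functor_def
  by (rule one_one_le[symmetric]) (use assms(2) globe_dim_le[OF y] x bd_le_cell in auto)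

text \<open>Serves composition: a factor whose image has dimension at most \<open>k\<close> is
  neutral for composing along degree \<open>k\<close>.\<close>

lemma globe_functor_unit:
  assumes y: "y \<in> oriental_cells m p" and "globe_dim y \<le> k" "k < p"
  shows "G p y = one C k p (bd C \<alpha> p k (G p y))"
proof -
  have "one C k p (G k y) = G p y"
    unfolding globe_functor_def
    by (rule one_one_le) (use assms globe_dim_le[OF y] x bd_le_cell in auto)
  then show ?thesis
    using globe_functor_bd_small[OF y assms(2)] globe_functor_bd[OF y assms(3)] by metis
qed

text \<open>In a globe, two cells compose along degree \<open>k\<close> only if one of them is a
  unit there, so functoriality reduces to the unit laws.\<close>

lemma globe_functor_cmp:
  assumes yz: "composable (oriental m) p k y z"
  shows "G p (cmp (oriental m) p k y z) = cmp C p k (G p y) (G p z)"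
proof -
  let ?w = "cmp (oriental m) p k y z"
  note c = composable_orientalD[OF yz]
  note y = c(2) and z = c(3)
  note app = oriental_cmp_apply[OF yz]
  note ty = total_eq_iff_le_globe_dim[OF y] and tz = total_eq_iff_le_globe_dim[OF z]
  have mid: "bd C Minus p k (G p y) = bd C Plus p k (G p z)"
    using globe_functor_bd[OF y c(1), of Minus] globe_functor_bd[OF z c(1), of Plus] yz
    by (simp add: composable_def)
  \<comment> \<open>If both images had dimension above \<open>k\<close>, the common boundary would
    have sign \<open>Minus\<close> as source of \<open>y\<close> and sign \<open>Plus\<close> as
    target of \<open>z\<close>.\<close>
  have "globe_dim y \<le> k \<or> globe_dim z \<le> k"
  proof (rule ccontr)
    assume "\<not> ?thesis"
    then have "globe_sign k (y k Minus) = Minus" "globe_sign k (z k Plus) = Plus"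
      using globe_sign_less[OF y] globe_sign_less[OF z] by auto
    then show False
      by (simp add: c(5))
  qed
  then show ?thesis
  proof
    assume small: "globe_dim y \<le> k"
    have dim: "globe_dim ?w = globe_dim z"
    proof (rule globe_dim_eqI)
      fix j
      have "id_total (y k Plus) = id_total (z k Plus)"
        using total_coeff_sign[OF y mono_ident, of k Plus Minus] c(5) by simp
      then show "id_total (?w (Suc j) Plus) = of_bool (Suc j \<le> globe_dim z)"
        using small by (auto simp: app coeff_add tz ty)
    qed
    \<comment> \<open>The \<open>Minus\<close> entry is compared first because in degree
      \<open>k\<close> it comes from \<open>z\<close>, whereas the \<open>Plus\<close> entry there
      comes from \<open>y\<close>.\<close>
    have "id_atom (?w (globe_dim z) Minus) = id_atom (z (globe_dim z) Minus)"
      using small atom_eq_0[OF y] by (auto simp: app coeff_add)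
    then have "id_atom (?w (globe_dim z) Plus) = id_atom (z (globe_dim z) Plus)"
      using atom_globe_dim[OF oriental_cmp_cell[OF yz], of Plus Minus] atom_globe_dim[OF z, of Plus Minus] dim
      by simp
    then have "G p ?w = G p z"
      by (rule globe_functor_cong[OF dim])
    also have "\<dots> = cmp C p k (one C k p (bd C Plus p k (G p z))) (G p z)"
      using cmp_one_left[OF c(1) globe_functor_cell[OF z]] by simp
    also have "\<dots> = cmp C p k (G p y) (G p z)"
      using globe_functor_unit[OF y small c(1), of Minus] mid by simp
    finally show ?thesis .
  next
    assume small: "globe_dim z \<le> k"
    have dim: "globe_dim ?w = globe_dim y"
    proof (rule globe_dim_eqI)
      fix j
      have "id_total (z j Plus) = id_total (y j Plus)" if "j < k" for j
        using c(4)[OF that, of Plus] by simp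
      then show "id_total (?w (Suc j) Plus) = of_bool (Suc j \<le> globe_dim y)"
        using small by (auto simp: app coeff_add ty tz)
    qed
    have "id_atom (?w (globe_dim y) Plus) = id_atom (y (globe_dim y) Plus)"
      using small atom_eq_0[OF z] c(4) by (auto simp: app coeff_add)
    then have "G p ?w = G p y"
      by (rule globe_functor_cong[OF dim])
    also have "\<dots> = cmp C p k (G p y) (one C k p (bd C Minus p k (G p y)))"
      using cmp_one_right[OF c(1) globe_functor_cell[OF y]] by simp
    also have "\<dots> = cmp C p k (G p y) (G p z)"
      using globe_functor_unit[OF z small c(1), of Plus] mid by simp
    finally show ?thesis .
  qed
qed

lemma globe_functor_Hom:
  "(\<lambda>p. restrict (G p) (oriental_cells m p)) \<in> omega_Hom (oriental m) C"
proof -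
  have "cmp (oriental m) p k y z \<in> oriental_cells m p \<and> y \<in> oriental_cells m p \<and> z \<in> oriental_cells m p"
    if "composable (oriental m) p k y z" for p k y z
    using oriental_cmp_cell[OF that] composable_orientalD[OF that] by blast
  then show ?thesis
    by (auto simp: omega_Hom_def globe_functor_cell globe_functor_bd globe_functor_cmp globe_functor_one
        oriental_bd_cell oriental_one_cell)
qed

text \<open>The top entry of the atom is the full simplex, so the image has dimension
  \<open>m\<close> and neither a boundary nor a unit is applied to \<open>x\<close>.\<close>

lemma globe_functor_top: "G m (oriental_top m) = x"
proof -
  have "id_total (oriental_atom m m Plus) \<noteq> 0"
    using globe_atom_upt[of 0 "Suc m"] globe_atom_le_total[of "[0..<Suc m]" 0]
    by (simp add: oriental_atom_def gale_chain_full total_coeff_def del: upt_Suc gale_chain.simps)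
  then have "globe_dim (oriental_atom m) = m"
    using globe_dim_le[OF oriental_atom_cell, of m]
    by (simp add: total_eq_iff_le_globe_dim[OF oriental_atom_cell])
  then show ?thesis
    by (simp add: oriental_top_eq_atom globe_functor_def one_le_def bd_le_def)
qed

end

end

section \<open>Triviality of the nerve and of the category\<close>

theorem mainTheorem3:
  fixes C :: "'a omega_cat" and n :: nat
  assumes "omega_category C"
  shows "stratified_trivial n (street_nerve C) \<longleftrightarrow> omega_cat_trivial n C"
proof
  interpret omega_category C by (rule assms)
  assume triv: "stratified_trivial n (street_nerve C)"
  show "omega_cat_trivial n C"
    unfolding omega_cat_trivial_def
  proof (intro allI impI ballI)
    fix m x assume "n < m" and x: "x \<in> Cells C m"
    then have "omega_Hom (oriental m) C \<subseteq> marked (street_nerve C) m"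
      using triv by (simp add: stratified_trivial_def street_nerve_def)
    \<comment> \<open>The simplex given by the globe functor of \<open>x\<close> takes the value
      \<open>x\<close> at the top cell, so its being marked is the weak invertibility of
      \<open>x\<close>.\<close>
    from subsetD[OF this globe_functor_Hom[OF x]] show "weakly_invertible C m x"
      using globe_functor_top[OF x] oriental_atom_cell[of m]
      by (simp add: street_nerve_def oriental_top_eq_atom)
  qed
next
  assume triv: "omega_cat_trivial n C"
  have "f m (oriental_top m) \<in> Cells C m" if "f \<in> omega_Hom (oriental m) C" for m f
    using that oriental_atom_cell[of m] by (auto simp: omega_Hom_def oriental_top_eq_atom PiE_def Pi_def)
  then show "stratified_trivial n (street_nerve C)"
    using triv by (auto simp: stratified_trivial_def street_nerve_def omega_cat_trivial_def)
qed

end
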